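(* Let $j\in\mathbb{N}$, let $n \in \mathbb{O}_+$ satisfy $C^j(n)=n$, with reduced Collatz trajectory $$n \xrightarrow{a_1} C(n) \xrightarrow{a_2} \cdots \xrightarrow{a_{j-1}} C^{j-1}(n) \xrightarrow{a_j} n.$$ If there exists $m \in \mathbb{O}_+$ such that $C^j(m) = 1$ with reduced Collatz trajectory having the same exponents, $$m \xrightarrow{a_1} C(m) \xrightarrow{a_2} \cdots \xrightarrow{a_{j-1}} C^{j-1}(m) \xrightarrow{a_j} 1,$$ then $n = 3^j\cdot 2k + 1$ for some $k \in \mathbb{N}_0$.
   Context: $\mathbb{N}$ denotes the positive integers, $\mathbb{N}_0=\mathbb{N}\cup\{0\}$, and $\mathbb{O}_+$ the set of positive odd integers. The reduced Collatz function $C : \mathbb{O}_+ \to \mathbb{O}_+$ is $C(n) = \frac{3n+1}{2^a}$, where $a \in \mathbb{N}$ is the largest exponent such that $2^a \mid 3n+1$; $C^i$ is its $i$-th iterate. The notation $n \xrightarrow{a_1} C(n) \xrightarrow{a_2} \cdots \xrightarrow{a_j} C^j(n)$ means that for each $1\le i\le j$, $a_i$ is the largest exponent with $2^{a_i} \mid 3C^{i-1}(n)+1$, so that $C^i(n) = (3C^{i-1}(n)+1)/2^{a_i}$ (with $C^0(n)=n$). *)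

theory Defs
  imports "HOL-Computational_Algebra.Primes"
begin

text \<open>Elements of the set of positive odd integers are rendered as natural numbers \<open>n\<close> with
  \<open>odd n\<close>; positivity is then automatic.\<close>

definition collatz_exponent :: "nat \<Rightarrow> nat" where
  "collatz_exponent n = multiplicity 2 (3 * n + 1)"

definition reduced_collatz :: "nat \<Rightarrow> nat" where
  "reduced_collatz n = (3 * n + 1) div 2 ^ collatz_exponent n"

text \<open>\<open>collatz_trajectory n a j m\<close> is the arrow notation
  \<open>n \<rightarrow> C(n) \<rightarrow> \<dots> \<rightarrow> C\<^sup>j(n) = m\<close> with arrows labelled \<open>a 1, \<dots>, a j\<close>. Values of \<open>a\<close> outside
  \<open>{1..j}\<close> are irrelevant.\<close>

definition collatz_trajectory :: "nat \<Rightarrow> (nat \<Rightarrow> nat) \<Rightarrow> nat \<Rightarrow> nat \<Rightarrow> bool" where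
  "collatz_trajectory n a j m \<longleftrightarrow>
     (\<forall>i\<in>{1..j}. a i = collatz_exponent ((reduced_collatz ^^ (i - 1)) n)) \<and>
     (reduced_collatz ^^ j) n = m"

text \<open>The division is exact, and \<open>reduced_collatz\<close> maps positive odd integers to
  positive odd integers, with positive exponents.\<close>

lemma reduced_collatz_mult: "reduced_collatz n * 2 ^ collatz_exponent n = 3 * n + 1"
  unfolding reduced_collatz_def collatz_exponent_def
  by (rule dvd_div_mult_self) (rule multiplicity_dvd)

lemma odd_reduced_collatz: "odd (reduced_collatz n)"
  unfolding reduced_collatz_def collatz_exponent_def
  by (rule multiplicity_decompose) simp_all

lemma collatz_exponent_pos:
  assumes "odd n"
  shows "collatz_exponent n > 0"
proof -
  have "2 dvd 3 * n + 1" using assms by simp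
  then show ?thesis
    unfolding collatz_exponent_def by (subst prime_multiplicity_gt_zero_iff) simp_all
qed

end

theory Submission
  imports Defs
begin

text \<open>Two trajectories with the same exponents are images under the same affine map, of slope
  \<open>3\<^sup>j / 2\<^sup>A\<close> with \<open>A = a\<^sub>1 + \<dots> + a\<^sub>j\<close>. Comparing the cycle through \<open>n\<close> with the trajectory
  from \<open>m\<close> to \<open>1\<close> gives \<open>2\<^sup>A (n - 1) = 3\<^sup>j (n - m)\<close>, so \<open>3\<^sup>j\<close> divides the even number
  \<open>n - 1\<close>.\<close>

text \<open>Splitting off the last arrow rather than the first keeps the starting point fixed, so
  the induction on \<open>j\<close> below only varies the endpoints.\<close>

lemma collatz_trajectory_SucD:
  assumes "collatz_trajectory n a (Suc j) p"
  obtains q where "collatz_trajectory n a j q" "p * 2 ^ a (Suc j) = 3 * q + 1"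
proof
  let ?q = "(reduced_collatz ^^ j) n"
  show "collatz_trajectory n a j ?q"
    using assms by (auto simp: collatz_trajectory_def)
  have "a (Suc j) = collatz_exponent ?q" "p = reduced_collatz ?q"
    using assms by (auto simp: collatz_trajectory_def)
  then show "p * 2 ^ a (Suc j) = 3 * ?q + 1"
    using reduced_collatz_mult by simp
qed

text \<open>In each step the summand 1 cancels from the difference, leaving only the factors 3 and
  \<open>2 ^ a i\<close>. The differences are taken in the integers because they may be
  negative.\<close>

lemma collatz_trajectory_diff:
  assumes "collatz_trajectory n a j p" "collatz_trajectory m a j q"
  shows "2 ^ (\<Sum>i=1..j. a i) * (int p - int q) = 3 ^ j * (int n - int m)"
  using assms
proof (induction j arbitrary: p q)
  case 0
  then show ?case by (simp add: collatz_trajectory_def)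
next
  case (Suc j)
  obtain p' where p': "collatz_trajectory n a j p'" "p * 2 ^ a (Suc j) = 3 * p' + 1"
    using Suc.prems(1) by (rule collatz_trajectory_SucD)
  obtain q' where q': "collatz_trajectory m a j q'" "q * 2 ^ a (Suc j) = 3 * q' + 1"
    using Suc.prems(2) by (rule collatz_trajectory_SucD)
  have "int p * 2 ^ a (Suc j) = 3 * int p' + 1" "int q * 2 ^ a (Suc j) = 3 * int q' + 1"
    using arg_cong[OF p'(2), of int] arg_cong[OF q'(2), of int] by simp_all
  then have step: "2 ^ a (Suc j) * (int p - int q) = 3 * (int p' - int q')"
    by (simp add: algebra_simps)
  have "2 ^ (\<Sum>i=1..Suc j. a i) * (int p - int q)
      = 2 ^ (\<Sum>i=1..j. a i) * (2 ^ a (Suc j) * (int p - int q))"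
    by (simp add: power_add)
  also have "\<dots> = 3 * (2 ^ (\<Sum>i=1..j. a i) * (int p' - int q'))"
    unfolding step by simp
  also have "\<dots> = 3 ^ Suc j * (int n - int m)"
    unfolding Suc.IH[OF p'(1) q'(1)] by simp
  finally show ?case .
qed

theorem theorem4p3:
  fixes j n :: nat and a :: "nat \<Rightarrow> nat"
  assumes "j \<ge> 1"
    and "odd n"
    and "(reduced_collatz ^^ j) n = n"
    and "collatz_trajectory n a j n"
    and "\<exists>m. odd m \<and> (reduced_collatz ^^ j) m = 1 \<and> collatz_trajectory m a j 1"
  shows "\<exists>k::nat. n = 3 ^ j * (2 * k) + 1"
proof -
  obtain m where "collatz_trajectory m a j 1"
    using assms(5) by blast
  with assms(4) have eq: "2 ^ (\<Sum>i=1..j. a i) * (int n - int 1) = 3 ^ j * (int n - int m)"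
    by (rule collatz_trajectory_diff)
  have n: "n \<ge> 1"
    using assms(2) by (cases n) auto
  have "3 ^ j dvd 2 ^ (\<Sum>i=1..j. a i) * (int n - int 1)"
    unfolding eq by simp
  moreover have "coprime (3 ^ j) (2 ^ (\<Sum>i=1..j. a i) :: int)"
    by simp
  ultimately have "3 ^ j dvd int n - int 1"
    using coprime_dvd_mult_right_iff by blast
  \<comment> \<open>Since \<open>n \<ge> 1\<close>, truncated subtraction agrees with the integer
    one here.\<close>
  then have "int (3 ^ j) dvd int (n - 1)"
    using n by (simp add: of_nat_diff)
  then have "3 ^ j dvd n - 1"
    by (simp only: of_nat_dvd_iff)
  then obtain l where l: "n - 1 = 3 ^ j * l" ..
  have "even (n - 1)"
    using assms(2) by simp
  \<comment> \<open>As \<open>3 ^ j\<close> is odd, the factor 2 of \<open>n - 1\<close> must come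
    from \<open>l\<close>.\<close>
  then have "even l"
    unfolding l by simp
  then obtain k where "l = 2 * k" ..
  with l n have "n = 3 ^ j * (2 * k) + 1"
    by simp
  then show ?thesis ..
qed

end
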